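(* For every $\varepsilon>0$ there are infinitely many positive integers $n$ for which there exist connected nonisomorphic graphs $G,H$ on $n$ vertices with the same degree sequence and $b(G,H)>(1-\varepsilon)n$. Equivalently, $$\limsup_{n\to\infty}\frac{B(n)}{n}=1.$$
   Context: All graphs are finite and simple. For a graph $G$ and $v\in V(G)$, the graph $G-v$ (up to isomorphism) is a card of $G$; the vertex deck $\mathcal D(G)=\{G-v:v\in V(G)\}$ is a multiset. For graphs $G,H$ of the same order, the number of common cards is $b(G,H)=|\mathcal D(G)\cap\mathcal D(H)|$ (multiset intersection); equivalently, the maximum $m$ such that there are $m$ distinct vertices $v_i$ of $G$ and $m$ distinct vertices $w_i$ of $H$ with $G-v_i\cong H-w_i$ for all $i\le m$. For $n\ge 2$, $B(n)=\max b(G,H)$, the maximum being over all pairs of nonisomorphic graphs $G,H$ with $|V(G)|=|V(H)|=n$ (not required to be connected or to have the same degree sequence). Two graphs have the same degree sequence if their multisets of vertex degrees agree. *)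

theory Defs
  imports "Graph_Theory.Graph_Theory" "HOL-Library.Multiset" "HOL-Library.Extended_Real"
begin

text \<open>
  A finite simple graph is a \<^locale>\<open>pair_graph\<close>: a finite, loop-free, symmetric digraph whose arcs
  are pairs of vertices, each edge being represented by its two orientations. Hence the degree of a
  vertex is its out-degree.
\<close>

definition iso_class :: "('a, 'b) pre_digraph \<Rightarrow> ('a, 'b) pre_digraph set" where
  "iso_class G = {K. digraph_iso K G}"

definition vertex_deck :: "('a, 'b) pre_digraph \<Rightarrow> ('a, 'b) pre_digraph set multiset" where
  "vertex_deck G = {# iso_class (pre_digraph.del_vert G v). v \<in># mset_set (verts G) #}"

definition common_cards :: "('a, 'b) pre_digraph \<Rightarrow> ('a, 'b) pre_digraph \<Rightarrow> nat" where
  "common_cards G H = size (vertex_deck G \<inter># vertex_deck H)"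

definition degree_sequence :: "('a, 'b) pre_digraph \<Rightarrow> nat multiset" where
  "degree_sequence G = {# out_degree G v. v \<in># mset_set (verts G) #}"

text \<open>
  Vertices are natural numbers, so every finite simple graph occurs up to isomorphism. For
  \<open>n \<ge> 2\<close> the set below is nonempty and bounded by \<open>n\<close>; for \<open>n < 2\<close> it is empty and the value is
  unspecified.
\<close>

definition max_common_cards :: "nat \<Rightarrow> nat" where
  "max_common_cards n = Max {b. \<exists>(G :: nat pair_pre_digraph) (H :: nat pair_pre_digraph).
     pair_graph G \<and> pair_graph H \<and> card (pverts G) = n \<and> card (pverts H) = n \<and>
     \<not> digraph_iso G H \<and> b = common_cards G H}"

end

theory Submission
  imports Defs "HOL-Library.Countable" "HOL-Combinatorics.Permutations"
begin

text \<open>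
  Fix a number \<open>q\<close> of hubs and attach \<open>x + p\<close> pendant leaves to hub \<open>p\<close>. For every even permutation
  of the hubs a clique of \<open>q\<close> flags is added that encodes this ordering of the hubs, so that the
  hubs can be permuted by automorphisms exactly as the alternating group allows. Composing the leaf
  counts with an odd permutation therefore yields a nonisomorphic graph. Deleting a leaf at a hub
  \<open>p > 0\<close>, however, makes the leaf counts of \<open>p\<close> and \<open>p - 1\<close> equal; exchanging these two hubs repairs
  the parity, and the corresponding cards of both graphs are isomorphic. Only the leaves at the
  hub \<open>0\<close> and a number of vertices depending on \<open>q\<close> alone are lost, so the proportion of common
  cards tends to \<open>1 - 1 / q\<close> as \<open>x\<close> grows.
\<close>

section \<open>Graphs induced by an adjacency relation\<close>

text \<open>The theorem speaks of graphs on \<open>nat\<close>, whereas the construction needs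
  structured vertices, so \<open>to_nat\<close> encodes a countable vertex type. The relation
  \<open>R\<close> lives on the whole type, hence deleting a vertex only shrinks
  \<open>V\<close>.\<close>

definition ind_graph :: "('v::countable \<Rightarrow> 'v \<Rightarrow> bool) \<Rightarrow> 'v set \<Rightarrow> nat pair_pre_digraph" where
  "ind_graph R V = \<lparr>pverts = to_nat ` V, parcs = {(to_nat u, to_nat v) | u v. u \<in> V \<and> v \<in> V \<and> R u v}\<rparr>"

lemma ind_graph_sel [simp]:
  "pverts (ind_graph R V) = to_nat ` V"
  "parcs (ind_graph R V) = {(to_nat u, to_nat v) | u v. u \<in> V \<and> v \<in> V \<and> R u v}"
  by (simp_all add: ind_graph_def)

lemma card_to_nat_image: "card (to_nat ` V) = card V"
  by (simp add: card_image)

lemma pair_wf_digraph_ind_graph: "pair_wf_digraph (ind_graph R V)"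
  by unfold_locales auto

lemma wf_digraph_ind_graph: "wf_digraph (with_proj (ind_graph R V))"
  by (simp add: wf_digraph_wp_iff pair_wf_digraph_ind_graph)

lemma pair_graph_ind_graph:
  assumes "finite V" "symp R" "irreflp R"
  shows "pair_graph (ind_graph R V)"
proof -
  have "finite (to_nat ` V \<times> to_nat ` V)" using assms(1) by simp
  then have "finite (parcs (ind_graph R V))"
    by (rule finite_subset[rotated]) auto
  moreover have "symmetric (with_proj (ind_graph R V))"
    using assms(2) by (fastforce simp: symmetric_def sym_def symp_def)
  moreover have "fst e \<noteq> snd e" if "e \<in> parcs (ind_graph R V)" for e
    using that assms(3) by (auto simp: irreflp_def)
  ultimately show ?thesis
    using assms(1) by unfold_locales auto
qed

lemma del_vert_ind_graph:
  "pre_digraph.del_vert (with_proj (ind_graph R V)) (to_nat v) = with_proj (ind_graph R (V - {v}))"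
  by (auto simp: pre_digraph.del_vert_def with_proj_def)

lemma digraph_iso_ind_graph:
  assumes "inj_on f V" "\<And>u v. u \<in> V \<Longrightarrow> v \<in> V \<Longrightarrow> R (f u) (f v) = R u v"
  shows "digraph_iso (ind_graph R V) (ind_graph R (f ` V))"
proof -
  define g where "g = (\<lambda>n. to_nat (f (from_nat n)))"
  \<comment> \<open>\<open>app_iso\<close> takes the head and tail maps of its result from
    \<open>h\<close>; they have to be \<open>snd\<close> and \<open>fst\<close> for the image to be
    a pair digraph again.\<close>
  define h where "h = \<lparr>iso_verts = g, iso_arcs = map_prod g g, iso_head = snd, iso_tail = fst\<rparr>"
  have g [simp]: "g (to_nat v) = to_nat (f v)" for v by (simp add: g_def)
  have inj: "inj_on g (to_nat ` V)"
    using assms(1) by (auto simp: inj_on_def)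
  have "inj_on (map_prod g g) (parcs (ind_graph R V))"
    using map_prod_inj_on[OF inj inj] by (rule inj_on_subset) auto
  then have "pre_digraph.digraph_isomorphism (ind_graph R V) h"
    using inj by (auto simp: pre_digraph.digraph_isomorphism_def wf_digraph_ind_graph h_def)
  moreover have "with_proj (ind_graph R (f ` V)) = app_iso h (ind_graph R V)"
  proof -
    have "map_prod g g ` parcs (ind_graph R V) = parcs (ind_graph R (f ` V))"
      using assms(2) by (force simp: image_iff)
    moreover have "g ` to_nat ` V = to_nat ` f ` V"
      by (simp add: image_image)
    ultimately show ?thesis
      by (simp add: app_iso_def with_proj_def h_def)
  qed
  ultimately show ?thesis
    by (auto simp: digraph_iso_def)
qed

lemma digraph_iso_ind_graphD:
  fixes R :: "'v::countable \<Rightarrow> 'v \<Rightarrow> bool"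
  assumes "digraph_iso (ind_graph R V) (ind_graph R W)"
  obtains f where "bij_betw f V W" "\<And>u v. u \<in> V \<Longrightarrow> v \<in> V \<Longrightarrow> R (f u) (f v) = R u v"
proof -
  from assms obtain h where h: "pre_digraph.digraph_isomorphism (ind_graph R V) h"
      "with_proj (ind_graph R W) = app_iso h (ind_graph R V)"
    by (auto simp: digraph_iso_def)
  define g where "g = iso_verts h"
  define f where "f = (\<lambda>v :: 'v. from_nat (g (to_nat v)) :: 'v)"
  have inj: "inj_on g (to_nat ` V)"
    using h(1) by (simp add: pre_digraph.digraph_isomorphism_def g_def)
  from arg_cong[OF h(2), of verts] have img: "to_nat ` W = g ` to_nat ` V"
    by (simp add: g_def)
  \<comment> \<open>The image has the head and tail maps of a pair digraph, so on arcs the arc map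
    of \<open>h\<close> can only be the vertex map applied to both ends.\<close>
  from arg_cong[OF h(2), of tail] arg_cong[OF h(2), of head]
  have "iso_tail h = fst" "iso_head h = snd" by simp_all
  with h(1) have arc: "iso_arcs h a = map_prod g g a" if "a \<in> parcs (ind_graph R V)" for a
    using that by (simp add: pre_digraph.digraph_isomorphism_def g_def prod_eq_iff)
  from arg_cong[OF h(2), of arcs]
  have "parcs (ind_graph R W) = iso_arcs h ` parcs (ind_graph R V)"
    unfolding arcs_app_iso with_proj_simps .
  also have "\<dots> = map_prod g g ` parcs (ind_graph R V)"
    by (intro image_cong refl arc)
  finally have arcs: "parcs (ind_graph R W) = map_prod g g ` parcs (ind_graph R V)" .
  have f: "f v \<in> W \<and> to_nat (f v) = g (to_nat v)" if "v \<in> V" for v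
  proof -
    have "g (to_nat v) \<in> to_nat ` W" using that img by auto
    then show ?thesis by (auto simp: f_def)
  qed
  have "inj_on f V"
    using inj f by (metis (mono_tags, lifting) image_eqI inj_on_def to_nat_split)
  moreover have "f ` V = W"
  proof
    show "f ` V \<subseteq> W" using f by auto
    show "W \<subseteq> f ` V"
    proof
      fix w assume "w \<in> W"
      then obtain v where "v \<in> V" "to_nat w = g (to_nat v)" using img by blast
      then show "w \<in> f ` V" using f by (metis image_eqI from_nat_to_nat)
    qed
  qed
  moreover have "R (f u) (f v) = R u v" if "u \<in> V" "v \<in> V" for u v
  proof -
    have "R (f u) (f v) \<longleftrightarrow> (to_nat (f u), to_nat (f v)) \<in> parcs (ind_graph R W)"
      using f[OF that(1), THEN conjunct1] f[OF that(2), THEN conjunct1] by auto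
    also have "\<dots> \<longleftrightarrow> (g (to_nat u), g (to_nat v)) \<in> map_prod g g ` parcs (ind_graph R V)"
      unfolding arcs using f that by simp
    also have "\<dots> \<longleftrightarrow> (to_nat u, to_nat v) \<in> parcs (ind_graph R V)"
      using inj that by (auto simp: inj_on_def)
    also have "\<dots> \<longleftrightarrow> R u v" using that by auto
    finally show ?thesis .
  qed
  ultimately show thesis
    using that by (auto simp: bij_betw_def)
qed

lemma out_degree_ind_graph:
  assumes "v \<in> V"
  shows "out_degree (ind_graph R V) (to_nat v) = card {u \<in> V. R v u}"
proof -
  have "out_arcs (with_proj (ind_graph R V)) (to_nat v) = (\<lambda>u. (to_nat v, to_nat u)) ` {u \<in> V. R v u}"
    using assms by (auto simp: out_arcs_def)
  then show ?thesis
    by (simp add: out_degree_def card_image inj_on_def)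
qed

text \<open>The two multisets of degrees are matched termwise along \<open>f\<close>, which need not
  preserve adjacency; this allows nonisomorphic graphs to be compared.\<close>

lemma degree_sequence_ind_graph_cong:
  fixes R :: "'v::countable \<Rightarrow> 'v \<Rightarrow> bool"
  assumes f: "bij_betw f V W" and "\<And>v. v \<in> V \<Longrightarrow> card {u \<in> W. R (f v) u} = card {u \<in> V. R v u}"
  shows "degree_sequence (ind_graph R V) = degree_sequence (ind_graph R W)"
proof -
  have inj: "inj_on to_nat A"  for A :: "'v set" by simp
  have "degree_sequence (ind_graph R U) = image_mset (\<lambda>v. card {u \<in> U. R v u}) (mset_set U)" for U
  proof (cases "finite U")
    case True
    then show ?thesis
      by (auto simp: degree_sequence_def image_mset_mset_set[OF inj, symmetric] multiset.map_comp
          out_degree_ind_graph intro!: image_mset_cong)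
  next
    case False
    then show ?thesis by (simp add: degree_sequence_def finite_image_iff)
  qed
  moreover have "mset_set W = image_mset f (mset_set V)"
    using f by (simp add: bij_betw_def image_mset_mset_set)
  ultimately show ?thesis
    using assms(2)
    by (cases "finite V") (auto simp: multiset.map_comp intro!: image_mset_cong)
qed

text \<open>By symmetry, walks into the single vertex \<open>z\<close> can be reversed, so any two
  vertices are joined by a walk through \<open>z\<close>.\<close>

lemma connected_ind_graph:
  assumes "z \<in> V" "symp R" and reach: "\<And>v. v \<in> V \<Longrightarrow> (\<lambda>a b. a \<in> V \<and> b \<in> V \<and> R a b)\<^sup>*\<^sup>* v z"
  shows "Digraph_Component.connected (ind_graph R V)"
proof -
  let ?G = "with_proj (ind_graph R V)"
  note wf = wf_digraph_ind_graph[of R V]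
  have sym: "symmetric ?G"
    using assms(2) by (fastforce simp: symmetric_def sym_def symp_def)
  have "to_nat v \<rightarrow>\<^sup>*\<^bsub>?G\<^esub> to_nat z" if "v \<in> V" for v
    using reach[OF that] that
  proof (induction rule: converse_rtranclp_induct)
    case base
    then show ?case using wf_digraph.reachable_refl[OF wf] by simp
  next
    case (step a b)
    then have "to_nat a \<rightarrow>\<^bsub>?G\<^esub> to_nat b" by auto
    with step show ?case using wf_digraph.adj_reachable_trans[OF wf] by blast
  qed
  then have "to_nat v \<rightarrow>\<^sup>*\<^bsub>?G\<^esub> to_nat w" if "v \<in> V" "w \<in> V" for v w
    using that symmetric_reachable[OF sym] wf_digraph.reachable_trans[OF wf] by blast
  then have "to_nat v \<rightarrow>\<^sup>*\<^bsub>mk_symmetric ?G\<^esub> to_nat w" if "v \<in> V" "w \<in> V" for v w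
    using that wf_digraph.reachable_mk_symmetricI[OF wf] by blast
  with assms(1) show ?thesis
    by (auto simp: Digraph_Component.connected_def strongly_connected_def mk_symmetric_def)
qed

text \<open>Carries local invariants along an isomorphism, since \<open>f\<close> maps the
  neighbours with property \<open>P\<close> onto one another. It is applied with \<open>P\<close>
  constantly true for degrees, and with \<open>is_Leaf\<close> or \<open>is_Hub\<close> for
  neighbours of one kind.\<close>

lemma card_nbrs_bij:
  assumes f: "bij_betw f V W" "\<And>u v. u \<in> V \<Longrightarrow> v \<in> V \<Longrightarrow> R (f u) (f v) = R u v"
    and P: "\<And>u. u \<in> V \<Longrightarrow> P (f u) = P u" and v: "v \<in> V"
  shows "card {w \<in> W. R (f v) w \<and> P w} = card {u \<in> V. R v u \<and> P u}"
proof -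
  have "{w \<in> W. R (f v) w \<and> P w} = f ` {u \<in> V. R v u \<and> P u}"
    using f(2)[OF v] P bij_betw_imp_surj_on[OF f(1)] by auto
  moreover have "inj_on f {u \<in> V. R v u \<and> P u}"
    using bij_betw_imp_inj_on[OF f(1)] by (rule inj_on_subset) auto
  ultimately show ?thesis by (simp add: card_image)
qed

section \<open>Common cards\<close>

lemma iso_class_eq:
  assumes "wf_digraph G" "digraph_iso G H"
  shows "iso_class G = iso_class H"
  unfolding iso_class_def using digraph_iso_trans digraph_iso_swap[OF assms] assms(2) by blast

text \<open>The cards at \<open>A\<close> form a submultiset of the first deck and, being equal to
  the cards at the images under the injection \<open>f\<close>, also of the second, hence of the
  intersection.\<close>

lemma common_cards_ge:
  assumes "finite (verts G)" "finite (verts H)" and A: "A \<subseteq> verts G" "inj_on f A" "f ` A \<subseteq> verts H"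
    and iso: "\<And>v. v \<in> A \<Longrightarrow>
      iso_class (pre_digraph.del_vert G v) = iso_class (pre_digraph.del_vert H (f v))"
  shows "card A \<le> common_cards G H"
proof -
  let ?c = "\<lambda>K v. iso_class (pre_digraph.del_vert K v)"
  have fin: "finite A" using assms finite_subset by blast
  have "image_mset (?c G) (mset_set A) \<subseteq># vertex_deck G"
    unfolding vertex_deck_def using assms by (intro image_mset_subseteq_mono subset_imp_msubset_mset_set)
  moreover have "image_mset (?c H) (mset_set (f ` A)) \<subseteq># vertex_deck H"
    unfolding vertex_deck_def using assms by (intro image_mset_subseteq_mono subset_imp_msubset_mset_set)
  moreover have "image_mset (?c H) (mset_set (f ` A)) = image_mset (?c G) (mset_set A)"
    using A(2) iso fin by (auto simp: image_mset_mset_set[symmetric] multiset.map_comp intro!: image_mset_cong)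
  ultimately have "image_mset (?c G) (mset_set A) \<subseteq># vertex_deck G \<inter># vertex_deck H"
    by simp
  from size_mset_mono[OF this] show ?thesis
    by (simp add: common_cards_def)
qed

lemma common_cards_le: "common_cards G H \<le> card (verts G)"
proof -
  have "common_cards G H \<le> size (vertex_deck G)"
    unfolding common_cards_def by (intro size_mset_mono) simp
  then show ?thesis by (simp add: vertex_deck_def)
qed

lemma finite_common_cards_values:
  "finite {b. \<exists>(G :: nat pair_pre_digraph) (H :: nat pair_pre_digraph).
     pair_graph G \<and> pair_graph H \<and> card (pverts G) = n \<and> card (pverts H) = n \<and>
     \<not> digraph_iso G H \<and> b = common_cards G H}"
  by (rule finite_subset[of _ "{..n}"]) (auto intro: order.trans[OF common_cards_le])

lemma common_cards_le_max:
  fixes G H :: "nat pair_pre_digraph"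
  assumes "pair_graph G" "pair_graph H" "card (pverts G) = n" "card (pverts H) = n" "\<not> digraph_iso G H"
  shows "common_cards G H \<le> max_common_cards n"
  unfolding max_common_cards_def using assms by (intro Max_ge finite_common_cards_values) blast

lemma max_common_cards_le:
  assumes "n \<ge> 2"
  shows "max_common_cards n \<le> n"
proof -
  \<comment> \<open>\<open>Max\<close> says nothing about the empty set, so a nonisomorphic pair has
    to be exhibited: the edgeless graph and the graph with one edge.\<close>
  let ?G = "\<lparr>pverts = {..<n}, parcs = {}\<rparr> :: nat pair_pre_digraph"
  let ?H = "\<lparr>pverts = {..<n}, parcs = {(0, 1), (1, 0)}\<rparr> :: nat pair_pre_digraph"
  let ?S = "{b. \<exists>(G :: nat pair_pre_digraph) (H :: nat pair_pre_digraph).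
     pair_graph G \<and> pair_graph H \<and> card (pverts G) = n \<and> card (pverts H) = n \<and>
     \<not> digraph_iso G H \<and> b = common_cards G H}"
  have "pair_graph ?G" by unfold_locales (auto simp: symmetric_def sym_def)
  moreover have "pair_graph ?H"
    using assms by unfold_locales (auto simp: symmetric_def sym_def)
  moreover have "\<not> digraph_iso ?G ?H"
    by (auto simp: digraph_iso_def app_iso_def with_proj_def)
  ultimately have "common_cards ?G ?H \<in> ?S" by fastforce
  then have "?S \<noteq> {}" by blast
  then have "Max ?S \<in> ?S" by (intro Max_in finite_common_cards_values)
  then obtain G H :: "nat pair_pre_digraph"
    where "card (pverts G) = n" "Max ?S = common_cards G H" by blast
  then show ?thesis
    unfolding max_common_cards_def using common_cards_le[of G H] by simp
qed

section \<open>Hubs, leaves and flags\<close>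

text \<open>\<open>Leaf p s\<close> is leaf number \<open>s\<close> at hub \<open>p\<close>, and
  \<open>Flag xs j\<close> is the vertex at position \<open>j\<close> in the clique belonging to the
  hub ordering \<open>xs\<close>.\<close>

datatype vertex = is_Hub: Hub nat | is_Leaf: Leaf nat nat | is_Flag: Flag "nat list" nat

instance vertex :: countable by countable_datatype

text \<open>\<open>Flag xs j\<close> sees the first \<open>Suc j\<close> hubs of \<open>xs\<close>.
  The clique of \<open>xs\<close> thus carries the chain of initial segments of \<open>xs\<close>,
  from which the ordering can be read back.\<close>

fun adj :: "vertex \<Rightarrow> vertex \<Rightarrow> bool" where
  "adj (Hub p) (Leaf p' s) \<longleftrightarrow> p = p'"
| "adj (Leaf p' s) (Hub p) \<longleftrightarrow> p = p'"
| "adj (Hub p) (Flag xs j) \<longleftrightarrow> p \<in> set (take (Suc j) xs)"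
| "adj (Flag xs j) (Hub p) \<longleftrightarrow> p \<in> set (take (Suc j) xs)"
| "adj (Flag xs j) (Flag ys k) \<longleftrightarrow> xs = ys \<and> j \<noteq> k"
| "adj _ _ \<longleftrightarrow> False"

lemma adj_sym: "adj u v = adj v u"
  by (cases u; cases v) auto

lemma symp_adj: "symp adj"
  using adj_sym by (simp add: symp_def)

lemma irreflp_adj: "irreflp adj"
  by (rule irreflpI, rename_tac v, case_tac v) auto

text \<open>The alternating group in one-line notation. Applying \<open>map \<pi>\<close> to such a
  list is composition with \<open>\<pi>\<close> from the left, so even permutations preserve the
  set, while odd ones move every element out of it.\<close>

definition even_orders :: "nat \<Rightarrow> nat list set" where
  "even_orders q = {map \<sigma> [0..<q] | \<sigma>. \<sigma> permutes {..<q} \<and> evenperm \<sigma>}"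

definition vertices :: "nat \<Rightarrow> (nat \<Rightarrow> nat) \<Rightarrow> vertex set" where
  "vertices q L = Hub ` {..<q} \<union> {Leaf p s | p s. p < q \<and> s < L p}
     \<union> {Flag xs j | xs j. xs \<in> even_orders q \<and> j < q}"

lemma vertices_simps [simp]:
  "Hub p \<in> vertices q L \<longleftrightarrow> p < q"
  "Leaf p s \<in> vertices q L \<longleftrightarrow> p < q \<and> s < L p"
  "Flag xs j \<in> vertices q L \<longleftrightarrow> xs \<in> even_orders q \<and> j < q"
  by (auto simp: vertices_def)

lemma finite_even_orders: "finite (even_orders q)"
  unfolding even_orders_def
  by (rule finite_subset[of _ "(\<lambda>\<sigma>. map \<sigma> [0..<q]) ` {\<sigma>. \<sigma> permutes {..<q}}"])
    (auto intro: finite_permutations)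

lemma even_ordersD:
  assumes "xs \<in> even_orders q"
  shows "length xs = q" "distinct xs" "set xs = {..<q}"
proof -
  from assms obtain \<sigma> where "xs = map \<sigma> [0..<q]" "\<sigma> permutes {..<q}"
    by (auto simp: even_orders_def)
  then show "length xs = q" "distinct xs" "set xs = {..<q}"
    by (auto simp: distinct_map permutes_inj_on permutes_image simp flip: lessThan_atLeast0)
qed

lemma upt_in_even_orders: "[0..<q] \<in> even_orders q"
  unfolding even_orders_def using permutes_id evenperm_id
  by (intro CollectI exI[of _ id]) auto

lemma map_in_even_orders:
  assumes "xs \<in> even_orders q" "\<pi> permutes {..<q}" "evenperm \<pi>"
  shows "map \<pi> xs \<in> even_orders q"
proof -
  from assms(1) obtain \<sigma> where \<sigma>: "xs = map \<sigma> [0..<q]" "\<sigma> permutes {..<q}" "evenperm \<sigma>"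
    by (auto simp: even_orders_def)
  have "permutation \<pi>" "permutation \<sigma>"
    using assms \<sigma> by (auto simp: permutation_permutes)
  then have "evenperm (\<pi> \<circ> \<sigma>)" using assms \<sigma> by (simp add: evenperm_comp)
  moreover have "\<pi> \<circ> \<sigma> permutes {..<q}" using assms \<sigma> permutes_compose by blast
  ultimately show ?thesis
    unfolding even_orders_def \<sigma>(1) map_map by blast
qed

lemma leaves_eq_Sigma: "{Leaf p s | p s. p \<in> P \<and> s < L p} = case_prod Leaf ` (SIGMA p:P. {..<L p})"
  by force

lemma card_leaves:
  "finite P \<Longrightarrow> card {Leaf p s | p s. p \<in> P \<and> s < L p} = (\<Sum>p\<in>P. L p)"
  unfolding leaves_eq_Sigma by (subst card_image) (auto simp: inj_on_def)

lemma flags_eq_image: "{Flag xs j | xs j. xs \<in> S \<and> j < q} = case_prod Flag ` (S \<times> {..<q})"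
  by force

lemma finite_vertices: "finite (vertices q L)"
  using leaves_eq_Sigma[of "{..<q}" L]
  by (auto simp: vertices_def flags_eq_image finite_even_orders)

text \<open>The number of leaves is kept apart from a summand that depends on \<open>q\<close> alone
  and stays bounded when the leaf counts grow.\<close>

lemma card_vertices:
  "card (vertices q L) = (\<Sum>p<q. L p) + (q + card (even_orders q) * q)"
proof -
  let ?H = "Hub ` {..<q}" and ?L = "{Leaf p s | p s. p \<in> {..<q} \<and> s < L p}"
    and ?F = "{Flag xs j | xs j. xs \<in> even_orders q \<and> j < q}"
  have fin: "finite ?L" "finite ?F"
    unfolding leaves_eq_Sigma flags_eq_image by (auto simp: finite_even_orders)
  have "card ?H = q" by (simp add: card_image inj_on_def)
  moreover have "card ?F = card (even_orders q) * q"
    unfolding flags_eq_image by (subst card_image) (auto simp: inj_on_def card_cartesian_product)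
  moreover have "vertices q L = ?L \<union> (?H \<union> ?F)" by (auto simp: vertices_def)
  moreover have "card (?L \<union> (?H \<union> ?F)) = card ?L + (card ?H + card ?F)"
    using fin by (subst card_Un_disjoint; (subst card_Un_disjoint)?) auto
  ultimately show ?thesis by (simp only: card_leaves finite_lessThan)
qed

section \<open>Relabelling the hubs by even permutations\<close>

primrec relabel :: "(nat \<Rightarrow> nat) \<Rightarrow> vertex \<Rightarrow> vertex" where
  "relabel \<pi> (Hub p) = Hub (\<pi> p)"
| "relabel \<pi> (Leaf p s) = Leaf (\<pi> p) s"
| "relabel \<pi> (Flag xs j) = Flag (map \<pi> xs) j"

lemma adj_relabel:
  assumes "inj \<pi>"
  shows "adj (relabel \<pi> u) (relabel \<pi> v) = adj u v"
  using assms
  by (cases u; cases v) (auto simp: inj_eq take_map inj_image_mem_iff)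

lemma inj_relabel: "inj \<pi> \<Longrightarrow> inj (relabel \<pi>)"
proof (rule injI)
  fix u v assume "inj \<pi>" "relabel \<pi> u = relabel \<pi> v"
  then show "u = v" by (cases u; cases v) (auto simp: inj_eq)
qed

lemma relabel_inv: "\<pi> permutes S \<Longrightarrow> relabel \<pi> (relabel (inv \<pi>) v) = v"
  by (cases v) (auto simp: permutes_inverses map_idI)

text \<open>Hub \<open>p\<close> with its \<open>L (\<pi> p)\<close> leaves goes to hub
  \<open>\<pi> p\<close>, where exactly that many are expected. Evenness of \<open>\<pi>\<close>
  ensures that flags go to flags of the same graph.\<close>

lemma relabel_vertices:
  assumes "\<pi> permutes {..<q}" "evenperm \<pi>"
  shows "relabel \<pi> ` vertices q (L \<circ> \<pi>) = vertices q L"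
proof
  have "relabel \<pi> v \<in> vertices q L" if "v \<in> vertices q (L \<circ> \<pi>)" for v
    using that permutes_in_image[OF assms(1)] map_in_even_orders[OF _ assms]
    by (cases v) simp_all
  then show "relabel \<pi> ` vertices q (L \<circ> \<pi>) \<subseteq> vertices q L" by blast
  show "vertices q L \<subseteq> relabel \<pi> ` vertices q (L \<circ> \<pi>)"
  proof
    fix v assume v: "v \<in> vertices q L"
    have inv: "inv \<pi> permutes {..<q}" "evenperm (inv \<pi>)"
      using assms by (simp_all add: permutes_inv evenperm_inv permutes_imp_permutation[of "{..<q}"])
    have "relabel (inv \<pi>) v \<in> vertices q (L \<circ> \<pi>)"
      using v inv permutes_in_image[OF inv(1)] permutes_inverses[OF assms(1)]
        map_in_even_orders[OF _ inv]
      by (cases v) simp_all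
    then show "v \<in> relabel \<pi> ` vertices q (L \<circ> \<pi>)"
      by (rule rev_image_eqI) (simp add: relabel_inv[OF assms(1)])
  qed
qed

abbreviation hub_graph :: "nat \<Rightarrow> (nat \<Rightarrow> nat) \<Rightarrow> nat pair_pre_digraph" where
  "hub_graph q L \<equiv> ind_graph adj (vertices q L)"

lemma digraph_iso_hub_graph_relabel:
  assumes "\<pi> permutes {..<q}" "evenperm \<pi>"
  shows "digraph_iso (hub_graph q (L \<circ> \<pi>)) (hub_graph q L)"
proof -
  have "inj \<pi>" using assms(1) by (rule permutes_inj)
  then have "digraph_iso (hub_graph q (L \<circ> \<pi>)) (ind_graph adj (relabel \<pi> ` vertices q (L \<circ> \<pi>)))"
    by (intro digraph_iso_ind_graph inj_on_subset[OF inj_relabel] adj_relabel) auto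
  then show ?thesis by (simp only: relabel_vertices[OF assms])
qed

lemma digraph_iso_delete_leaf:
  assumes "p < q" "s < L p"
  shows "digraph_iso (ind_graph adj (vertices q L - {Leaf p s})) (hub_graph q (L(p := L p - 1)))"
proof -
  \<comment> \<open>The leaves at one hub are interchangeable. Swapping the deleted leaf with the
    last one, of index \<open>L p - 1\<close>, makes the remaining indices an initial segment
    again.\<close>
  let ?f = "transpose (Leaf p s) (Leaf p (L p - 1))"
  have "adj (?f u) (?f v) = adj u v" for u v
    by (cases u; cases v) (auto simp: transpose_def)
  moreover have "?f ` (vertices q L - {Leaf p s}) = vertices q (L(p := L p - 1))"
  proof -
    have "?f ` (vertices q L - {Leaf p s}) = ?f ` vertices q L - {Leaf p (L p - 1)}"
      by (simp add: image_set_diff)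
    also have "?f ` vertices q L = vertices q L"
      using assms by (simp add: transpose_image_eq)
    also have "vertices q L - {Leaf p (L p - 1)} = vertices q (L(p := L p - 1))"
      using assms by (intro set_eqI, rename_tac v, case_tac v) auto
    finally show ?thesis .
  qed
  ultimately show ?thesis
    using digraph_iso_ind_graph[of ?f "vertices q L - {Leaf p s}" adj] by simp
qed

lemma connected_hub_graph:
  assumes "q > 0"
  shows "Digraph_Component.connected (hub_graph q L)"
\<comment> \<open>The last flag of the identity ordering sees all hubs. A leaf reaches it through
  its hub, any flag through the first hub of its own list.\<close>
proof (rule connected_ind_graph[where z = "Flag [0..<q] (q - 1)"])
  let ?V = "vertices q L" and ?z = "Flag [0..<q] (q - 1)"
  let ?r = "\<lambda>a b. a \<in> ?V \<and> b \<in> ?V \<and> adj a b"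
  show z: "?z \<in> ?V" using assms by (simp add: upt_in_even_orders)
  have hub: "?r\<^sup>*\<^sup>* (Hub p) ?z" if "p < q" for p
    using that z by (intro r_into_rtranclp) auto
  fix v assume v: "v \<in> ?V"
  show "?r\<^sup>*\<^sup>* v ?z"
  proof (cases v)
    case (Hub p)
    then show ?thesis using hub v by simp
  next
    case (Leaf p s)
    then have "?r v (Hub p)" using v by simp
    then show ?thesis using hub[of p] v Leaf
      by (metis (no_types, lifting) converse_rtranclp_into_rtranclp vertices_simps(2))
  next
    case (Flag xs j)
    then have xs: "length xs = q" "set xs = {..<q}" using v even_ordersD by auto
    then have "hd xs \<in> set (take (Suc j) xs)" "hd xs < q"
      using assms by (cases xs; auto)+
    then have "?r v (Hub (hd xs))" using v Flag by simp
    then show ?thesis using hub[of "hd xs"] \<open>hd xs < q\<close>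
      by (metis (no_types, lifting) converse_rtranclp_into_rtranclp)
  qed
qed (rule symp_adj)

section \<open>Recovering the hub permutation from an isomorphism\<close>

text \<open>A hub has at least two leaves, and a flag has at least two other flags in its clique
  because \<open>q \<ge> 3\<close>; only leaves have degree one. The conjunct \<open>True\<close>
  gives the cardinality the form of \<open>card_nbrs_bij\<close>.\<close>

lemma is_Leaf_iff_degree:
  assumes "q \<ge> 3" "\<And>p. p < q \<Longrightarrow> L p \<ge> 2" "v \<in> vertices q L"
  shows "is_Leaf v \<longleftrightarrow> card {u \<in> vertices q L. adj v u \<and> True} = 1"
proof -
  let ?N = "{u \<in> vertices q L. adj v u}"
  have two: "card ?N \<noteq> 1" if "a \<in> ?N" "b \<in> ?N" "a \<noteq> b" for a b
    using that by (metis card_1_singletonE singletonD)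
  show ?thesis
  proof (cases v)
    case (Hub p)
    then have "Leaf p 0 \<in> ?N" "Leaf p 1 \<in> ?N" using assms(2)[of p] assms(3) by auto
    from two[OF this] show ?thesis using Hub by simp
  next
    case (Leaf p s)
    then have "?N = {Hub p}"
      using assms(3) by (intro set_eqI, rename_tac u, case_tac u) auto
    with Leaf show ?thesis by simp
  next
    case (Flag xs j)
    obtain a b where ab: "a < 3" "b < 3" "a \<noteq> b" "a \<noteq> j" "b \<noteq> j"
      by (metis numeral_3_eq_3 less_Suc_eq nat_neq_iff)
    then have "Flag xs a \<in> ?N" "Flag xs b \<in> ?N" using assms(1,3) Flag by auto
    from two[OF this] show ?thesis using Flag ab(3) by simp
  qed
qed

text \<open>Flags have no leaf neighbours, whereas every hub has some. Once isomorphisms are known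
  to preserve leaves, this shows that they preserve hubs too.\<close>

lemma is_Hub_iff_leaf_nbr:
  assumes "\<And>p. p < q \<Longrightarrow> L p \<ge> 2" "v \<in> vertices q L"
  shows "is_Hub v \<longleftrightarrow> \<not> is_Leaf v \<and> card {u \<in> vertices q L. adj v u \<and> is_Leaf u} \<noteq> 0"
proof (cases v)
  case (Hub p)
  then have "Leaf p 0 \<in> {u \<in> vertices q L. adj v u \<and> is_Leaf u}"
    using assms(1)[of p] assms(2) by auto
  moreover have "finite {u \<in> vertices q L. adj v u \<and> is_Leaf u}"
    using finite_vertices by simp
  ultimately have "card {u \<in> vertices q L. adj v u \<and> is_Leaf u} \<noteq> 0"
    by (metis (no_types, lifting) card_0_eq empty_iff)
  then show ?thesis using Hub by simp
next
  case (Flag xs j)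
  then have "{u \<in> vertices q L. adj v u \<and> is_Leaf u} = {}"
    by (auto simp: is_Leaf_def)
  then have "card {u \<in> vertices q L. adj v u \<and> is_Leaf u} = 0" by (simp only: card.empty)
  then show ?thesis using Flag by simp
qed simp

lemma card_leaf_nbrs:
  assumes "p < q"
  shows "card {u \<in> vertices q L. adj (Hub p) u \<and> is_Leaf u} = L p"
proof -
  have "{u \<in> vertices q L. adj (Hub p) u \<and> is_Leaf u} = Leaf p ` {..<L p}"
    using assms by (auto simp: is_Leaf_def)
  then show ?thesis by (simp add: card_image inj_on_def)
qed

lemma hub_nbrs_Flag:
  assumes "xs \<in> even_orders q"
  shows "{u \<in> vertices q L. adj (Flag xs j) u \<and> is_Hub u} = Hub ` set (take (Suc j) xs)"
proof -
  have "p < q" if "p \<in> set (take (Suc j) xs)" for p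
    using in_set_takeD[OF that] even_ordersD(3)[OF assms] by simp
  then show ?thesis by (intro set_eqI, rename_tac u, case_tac u) auto
qed

text \<open>The first \<open>Suc j\<close> entries of \<open>xs\<close> are distinct, so the
  position of a flag in its clique is an invariant.\<close>

lemma card_hub_nbrs_Flag:
  assumes "xs \<in> even_orders q" "j < q"
  shows "card {u \<in> vertices q L. adj (Flag xs j) u \<and> is_Hub u} = Suc j"
proof -
  have "card (Hub ` set (take (Suc j) xs)) = card (set (take (Suc j) xs))"
    by (intro card_image) (simp add: inj_on_def)
  also have "\<dots> = length (take (Suc j) xs)"
    using even_ordersD(2)[OF assms(1)] by (intro distinct_card distinct_take)
  finally show ?thesis
    using assms even_ordersD(1)[OF assms(1)] by (simp only: hub_nbrs_Flag length_take)
qed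

text \<open>In a distinct list, entry number \<open>j\<close> is the only element by which the
  initial segment of length \<open>Suc j\<close> exceeds the one of length \<open>j\<close>.\<close>

lemma list_eq_if_set_take_eq:
  assumes "length xs = length ys" "distinct xs" "distinct ys"
    and "\<And>j. j < length xs \<Longrightarrow> set (take (Suc j) xs) = set (take (Suc j) ys)"
  shows "xs = ys"
proof (rule nth_equalityI)
  have nth: "{zs ! j} = set (take (Suc j) zs) - set (take j zs)"
    if "distinct zs" "j < length zs" for zs :: "'a list" and j
    using that distinct_take[OF that(1), of "Suc j"] by (auto simp: take_Suc_conv_app_nth)
  fix j assume j: "j < length xs"
  have "set (take j xs) = set (take j ys)"
    using assms(4)[of "j - 1"] j by (cases j) auto
  then have "{xs ! j} = {ys ! j}"
    using nth[OF assms(2) j] nth[OF assms(3), of j] assms(1) assms(4)[OF j] j by simp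
  then show "xs ! j = ys ! j" by simp
qed (rule assms(1))

text \<open>An isomorphism preserves the three kinds of vertices. The distinct leaf counts force it
  to act on the hubs as the inverse of \<open>\<pi>\<close>, and the clique of the identity ordering
  must then go to the clique of that inverse in one-line notation. Only even orderings have
  cliques.\<close>

lemma evenperm_if_digraph_iso:
  assumes q: "q \<ge> 3" and L: "inj_on L {..<q}" "\<And>p. p < q \<Longrightarrow> L p \<ge> 2"
    and \<pi>: "\<pi> permutes {..<q}" and iso: "digraph_iso (hub_graph q L) (hub_graph q (L \<circ> \<pi>))"
  shows "evenperm \<pi>"
proof -
  let ?V = "vertices q L" and ?W = "vertices q (L \<circ> \<pi>)"
  obtain f where f: "bij_betw f ?V ?W" "\<And>u v. u \<in> ?V \<Longrightarrow> v \<in> ?V \<Longrightarrow> adj (f u) (f v) = adj u v"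
    using digraph_iso_ind_graphD[OF iso] by blast
  have fW: "f v \<in> ?W" if "v \<in> ?V" for v using f(1) that by (auto simp: bij_betw_def)
  have \<pi>_lt: "\<pi> p < q \<longleftrightarrow> p < q" for p using permutes_in_image[OF \<pi>, of p] by simp
  have L': "(L \<circ> \<pi>) p \<ge> 2" if "p < q" for p using L(2) \<pi>_lt that by simp
  have leaf: "is_Leaf (f v) = is_Leaf v" if "v \<in> ?V" for v
    using is_Leaf_iff_degree[OF q L' fW[OF that]] is_Leaf_iff_degree[OF q L(2) that]
      card_nbrs_bij[where R = adj and P = "\<lambda>_. True", OF f _ that] by simp
  have hub: "is_Hub (f v) = is_Hub v" if "v \<in> ?V" for v
    using is_Hub_iff_leaf_nbr[OF L' fW[OF that]] is_Hub_iff_leaf_nbr[OF L(2) that]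
      card_nbrs_bij[where R = adj and P = is_Leaf, OF f leaf that] leaf[OF that] by simp
  define \<rho> where "\<rho> = inv \<pi>"
  have \<rho>: "\<rho> permutes {..<q}" unfolding \<rho>_def using \<pi> by (rule permutes_inv)
  have f_Hub: "f (Hub p) = Hub (\<rho> p)" if p: "p < q" for p
  proof -
    have v: "Hub p \<in> ?V" using p by simp
    obtain p' where p': "f (Hub p) = Hub p'"
      using hub[OF v] by (auto simp: is_Hub_def)
    then have "p' < q" using fW[OF v] by simp
    \<comment> \<open>In the target, hub \<open>p'\<close> has \<open>L (\<pi> p')\<close> leaves;
      injectivity of \<open>L\<close> then determines \<open>p'\<close>.\<close>
    moreover have "(L \<circ> \<pi>) p' = L p"
      using card_nbrs_bij[where R = adj and P = is_Leaf, OF f leaf v] p p' \<open>p' < q\<close>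
      by (simp add: card_leaf_nbrs)
    ultimately have "\<pi> p' = p" using L(1) p \<pi>_lt by (auto simp: inj_on_def)
    then show ?thesis using p' permutes_inverses(2)[OF \<pi>] by (auto simp: \<rho>_def)
  qed
  define e where "e = [0..<q]"
  have e: "e \<in> even_orders q" unfolding e_def by (rule upt_in_even_orders)
  note e = e even_ordersD[OF e]
  have flag: "\<exists>xs k. f (Flag e j) = Flag xs k" if "j < q" for j
  proof -
    have v: "Flag e j \<in> ?V" using that e by simp
    show ?thesis using leaf[OF v] hub[OF v] by (cases "f (Flag e j)") auto
  qed
  obtain xs k0 where xs0: "f (Flag e 0) = Flag xs k0" using flag q by force
  have xs: "xs \<in> even_orders q" using fW[of "Flag e 0"] xs0 e q by simp
  have f_Flag: "f (Flag e j) = Flag xs j" if j: "j < q" for j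
  proof -
    have v: "Flag e j \<in> ?V" "Flag e 0 \<in> ?V" using j e by auto
    obtain ys k where ys: "f (Flag e j) = Flag ys k" using flag j by blast
    \<comment> \<open>Flags of different orderings are never adjacent, so the image of the whole
      clique carries the list found at position 0.\<close>
    have "ys = xs"
    proof (cases "j = 0")
      case False
      then have "adj (f (Flag e j)) (f (Flag e 0))" using f(2)[OF v] by simp
      then show ?thesis using ys xs0 by simp
    qed (use ys xs0 in simp)
    moreover have "k < q" using fW[OF v(1)] ys by simp
    \<comment> \<open>The number of hub neighbours is preserved, which identifies the position
      \<open>k\<close> with \<open>j\<close>.\<close>
    moreover have "card {u \<in> ?W. adj (Flag ys k) u \<and> is_Hub u} = Suc j"
      using card_nbrs_bij[where R = adj and P = is_Hub, OF f hub v(1)] ys card_hub_nbrs_Flag[OF e(1) j] by simp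
    ultimately show ?thesis using ys card_hub_nbrs_Flag[OF xs] by simp
  qed
  have "map \<rho> e = xs"
  proof (rule list_eq_if_set_take_eq)
    show "distinct (map \<rho> e)" using e(3) permutes_inj_on[OF \<rho>] by (simp add: distinct_map)
    show "length (map \<rho> e) = length xs" "distinct xs" using e(2) even_ordersD[OF xs] by simp_all
    fix j assume "j < length (map \<rho> e)"
    then have j: "j < q" using e by simp
    have "p \<in> set (take (Suc j) e) \<longleftrightarrow> \<rho> p \<in> set (take (Suc j) xs)" if "p < q" for p
      using f(2)[of "Flag e j" "Hub p"] that j e by (simp add: f_Flag f_Hub)
    \<comment> \<open>The equivalence above covers only \<open>p < q\<close>; these inclusions make
      it determine both segments completely.\<close>
    moreover have "set (take (Suc j) e) \<subseteq> {..<q}" "set (take (Suc j) xs) \<subseteq> \<rho> ` {..<q}"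
      using e(4) even_ordersD(3)[OF xs] set_take_subset by (fastforce simp: permutes_image[OF \<rho>])+
    ultimately have "set (take (Suc j) xs) = \<rho> ` set (take (Suc j) e)" by blast
    then show "set (take (Suc j) (map \<rho> e)) = set (take (Suc j) xs)" by (simp add: take_map)
  qed
  with xs obtain \<sigma> where \<sigma>: "map \<rho> [0..<q] = map \<sigma> [0..<q]" "\<sigma> permutes {..<q}" "evenperm \<sigma>"
    unfolding even_orders_def e_def by blast
  \<comment> \<open>The lists agree on the hubs, and both permutations fix everything else.\<close>
  have "\<rho> p = \<sigma> p" for p
    using \<sigma>(1) permutes_not_in[OF \<rho>, of p] permutes_not_in[OF \<sigma>(2), of p] by (cases "p < q") auto
  then have "\<rho> = \<sigma>" by blast
  then show ?thesis
    using \<sigma>(3) evenperm_inv[OF permutes_imp_permutation[OF _ \<pi>]] by (simp add: \<rho>_def)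
qed

section \<open>Equality of the degree sequences\<close>

text \<open>The alternating group is transitive on at least three hubs, so any hub can be moved to
  any other by an automorphism of the system of flags. Exchanging \<open>p\<close> and
  \<open>p'\<close> turns the inequality into equality.\<close>

lemma card_flags_at_le:
  assumes "q \<ge> 3" "p < q" "p' < q"
  shows "card {u \<in> vertices q L. adj (Hub p) u \<and> is_Flag u}
    \<le> card {u \<in> vertices q L. adj (Hub p') u \<and> is_Flag u}"
proof (cases "p = p'")
  case False
  have "card {p, p'} < card {..<q}" using assms False by simp
  then obtain r where r: "r < q" "r \<noteq> p" "r \<noteq> p'"
    by (metis card_mono finite.emptyI finite_insert insertI1 insertI2 lessThan_iff not_le subsetI)
  \<comment> \<open>A product of two transpositions, hence even: the 3-cycle sending
    \<open>p\<close> to \<open>p'\<close>, \<open>p'\<close> to \<open>r\<close> and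
    \<open>r\<close> to \<open>p\<close>.\<close>
  define \<pi> where "\<pi> = transpose p r \<circ> transpose p p'"
  have \<pi>: "\<pi> permutes {..<q}" "evenperm \<pi>" "\<pi> p = p'"
    unfolding \<pi>_def using r False assms
    by (auto simp: evenperm_comp permutation_swap_id evenperm_swap intro!: permutes_compose permutes_swap_id)
  have inj: "inj \<pi>" using \<pi>(1) by (rule permutes_inj)
  show ?thesis
  proof (rule card_inj_on_le[of "relabel \<pi>"])
    show "inj_on (relabel \<pi>) {u \<in> vertices q L. adj (Hub p) u \<and> is_Flag u}"
      using inj_relabel[OF inj] by (rule inj_on_subset) simp
    show "relabel \<pi> ` {u \<in> vertices q L. adj (Hub p) u \<and> is_Flag u}
        \<subseteq> {u \<in> vertices q L. adj (Hub p') u \<and> is_Flag u}"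
    proof safe
      fix u assume u: "u \<in> vertices q L" "adj (Hub p) u" "is_Flag u"
      show "relabel \<pi> u \<in> vertices q L" "is_Flag (relabel \<pi> u)"
        using u map_in_even_orders[OF _ \<pi>(1,2)] by (cases u; simp)+
      show "adj (Hub p') (relabel \<pi> u)"
        using u(2) adj_relabel[OF inj, of "Hub p" u] \<pi>(3) by simp
    qed
  qed (use finite_vertices in simp)
qed simp

lemma degree_sequence_hub_graph:
  assumes q: "q \<ge> 3" and \<tau>: "\<tau> permutes {..<q}"
  shows "degree_sequence (hub_graph q (L \<circ> \<tau>)) = degree_sequence (hub_graph q L)"
proof -
  let ?V = "vertices q (L \<circ> \<tau>)" and ?W = "vertices q L"
  have \<tau>_lt: "\<tau> p < q \<longleftrightarrow> p < q" for p using permutes_in_image[OF \<tau>, of p] by simp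
  \<comment> \<open>Hubs and leaves move along \<open>\<tau>\<close>, but flags stay fixed, since an
    odd \<open>\<tau>\<close> would carry their lists out of \<open>even_orders q\<close>. Adjacency
    between hubs and flags is lost; the degrees survive because all hubs see equally many
    flags.\<close>
  define f where "f = (\<lambda>v. if is_Flag v then v else relabel \<tau> v)"
  define g where "g = (\<lambda>v. if is_Flag v then v else relabel (inv \<tau>) v)"
  have inv_lt: "inv \<tau> p < q \<longleftrightarrow> p < q" for p
    using permutes_in_image[OF permutes_inv[OF \<tau>], of p] by simp
  have "bij_betw f ?V ?W"
  proof (rule bij_betw_byWitness[where f' = g])
    show "\<forall>v\<in>?V. g (f v) = v" "\<forall>v\<in>?W. f (g v) = v"
      by (rule ballI, rename_tac v, case_tac v, simp_all add: f_def g_def permutes_inverses[OF \<tau>])+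
    show "f ` ?V \<subseteq> ?W"
      by (rule image_subsetI, rename_tac v, case_tac v) (simp_all add: f_def \<tau>_lt)
    show "g ` ?W \<subseteq> ?V"
      by (rule image_subsetI, rename_tac v, case_tac v)
        (simp_all add: g_def permutes_inverses[OF \<tau>] inv_lt)
  qed
  moreover have "card {u \<in> ?W. adj (f v) u} = card {u \<in> ?V. adj v u}" if v: "v \<in> ?V" for v
  proof (cases v)
    case (Hub p)
    have split: "card {u \<in> vertices q M. adj (Hub p) u}
        = card {u \<in> vertices q M. adj (Hub p) u \<and> is_Leaf u}
          + card {u \<in> vertices q M. adj (Hub p) u \<and> is_Flag u}" for p M
    proof -
      have "{u \<in> vertices q M. adj (Hub p) u} = {u \<in> vertices q M. adj (Hub p) u \<and> is_Leaf u}
          \<union> {u \<in> vertices q M. adj (Hub p) u \<and> is_Flag u}"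
        by (intro set_eqI, rename_tac u, case_tac u) auto
      then show ?thesis
        using finite_vertices by (simp, subst card_Un_disjoint) (auto simp: is_Leaf_def)
    qed
    have "{u \<in> vertices q M. adj (Hub p) u \<and> is_Flag u}
        = {u \<in> vertices q M'. adj (Hub p) u \<and> is_Flag u}" for p M M'
      by (auto simp: is_Flag_def)
    moreover have "card {u \<in> vertices q M. adj (Hub p) u \<and> is_Flag u}
        = card {u \<in> vertices q M. adj (Hub (\<tau> p)) u \<and> is_Flag u}" for M
      using v Hub \<tau>_lt q by (intro antisym card_flags_at_le) auto
    ultimately show ?thesis
      using Hub v \<tau>_lt by (simp add: f_def split card_leaf_nbrs) metis
  next
    case (Leaf p s)
    have "{u \<in> vertices q M. adj (Leaf p s) u} = {Hub p}" if "p < q" for p s M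
      using that by (intro set_eqI, rename_tac u, case_tac u) auto
    then show ?thesis using Leaf v \<tau>_lt by (simp add: f_def)
  next
    case (Flag xs j)
    then have "{u \<in> ?W. adj (f v) u} = {u \<in> ?V. adj v u}"
      by (intro set_eqI, rename_tac u, case_tac u) (auto simp: f_def)
    then show ?thesis by simp
  qed
  ultimately show ?thesis by (rule degree_sequence_ind_graph_cong)
qed

section \<open>Cards with a leaf deleted\<close>

text \<open>Since \<open>L\<close> takes the same value at \<open>i\<close> and \<open>j\<close>,
  composing \<open>\<tau>\<close> with their transposition leaves the counts
  \<open>L \<circ> \<tau>\<close> unchanged and makes the permutation even.\<close>

lemma digraph_iso_hub_graph_odd:
  assumes "L i = L j" "i \<noteq> j" "i < q" "j < q" "\<tau> permutes {..<q}" "\<not> evenperm \<tau>"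
  shows "digraph_iso (hub_graph q (L \<circ> \<tau>)) (hub_graph q L)"
proof -
  let ?\<pi> = "transpose i j \<circ> \<tau>"
  have "permutation \<tau>" using permutes_imp_permutation[OF _ assms(5)] by simp
  then have "evenperm ?\<pi>"
    using assms by (simp add: evenperm_comp permutation_swap_id evenperm_swap)
  moreover have "?\<pi> permutes {..<q}"
    using assms by (intro permutes_compose permutes_swap_id) auto
  moreover have "L \<circ> ?\<pi> = L \<circ> \<tau>"
    using assms(1) by (auto simp: fun_eq_iff transpose_def)
  ultimately show ?thesis using digraph_iso_hub_graph_relabel by metis
qed

lemma iso_class_delete_leaf:
  assumes p: "0 < p" "p < q" and s: "s < L p" and L: "L (p - 1) = L p - 1"
    and \<tau>: "\<tau> permutes {..<q}" "\<not> evenperm \<tau>"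
  shows "iso_class (with_proj (ind_graph adj (vertices q (L \<circ> \<tau>) - {Leaf (inv \<tau> p) s})))
    = iso_class (with_proj (ind_graph adj (vertices q L - {Leaf p s})))"
proof -
  let ?L = "L(p := L p - 1)" and ?p = "inv \<tau> p"
  have \<tau>p: "\<tau> ?p = p" by (simp add: permutes_inverses[OF \<tau>(1)])
  then have "?p < q" using permutes_in_image[OF \<tau>(1), of ?p] p by simp
  \<comment> \<open>The hub called \<open>p\<close> in one graph is \<open>inv \<tau> p\<close> in
    the other, so lowering its count commutes with composition by \<open>\<tau>\<close>. In
    \<open>?L\<close> the hubs \<open>p - 1\<close> and \<open>p\<close> are tied.\<close>
  have upd: "(L \<circ> \<tau>)(?p := (L \<circ> \<tau>) ?p - 1) = ?L \<circ> \<tau>"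
  proof
    show "((L \<circ> \<tau>)(?p := (L \<circ> \<tau>) ?p - 1)) r = (?L \<circ> \<tau>) r" for r
      using \<tau>p by (cases "r = ?p") (auto simp: permutes_inverses[OF \<tau>(1)])
  qed
  have "digraph_iso (ind_graph adj (vertices q (L \<circ> \<tau>) - {Leaf ?p s}))
      (hub_graph q ((L \<circ> \<tau>)(?p := (L \<circ> \<tau>) ?p - 1)))"
    using \<open>?p < q\<close> s \<tau>p by (intro digraph_iso_delete_leaf) auto
  then have "digraph_iso (ind_graph adj (vertices q (L \<circ> \<tau>) - {Leaf ?p s})) (hub_graph q (?L \<circ> \<tau>))"
    unfolding upd .
  also have "digraph_iso (hub_graph q (?L \<circ> \<tau>)) (hub_graph q ?L)"
    using p L \<tau> by (intro digraph_iso_hub_graph_odd[of _ "p - 1" p]) auto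
  finally have "iso_class (with_proj (ind_graph adj (vertices q (L \<circ> \<tau>) - {Leaf ?p s})))
      = iso_class (with_proj (hub_graph q ?L))"
    by (rule iso_class_eq[OF wf_digraph_ind_graph])
  also have "\<dots> = iso_class (with_proj (ind_graph adj (vertices q L - {Leaf p s})))"
    using p s by (intro iso_class_eq[symmetric] digraph_iso_delete_leaf wf_digraph_ind_graph)
  finally show ?thesis .
qed

text \<open>With counts \<open>x + p\<close>, deleting a leaf at any hub \<open>p > 0\<close>
  creates a tie with hub \<open>p - 1\<close>. Each of these \<open>q - 1\<close> hubs contributes
  at least \<open>x\<close> matched cards.\<close>

lemma common_cards_hub_graph:
  assumes \<tau>: "\<tau> permutes {..<q}" "\<not> evenperm \<tau>"
  shows "(q - 1) * x \<le> common_cards (hub_graph q ((+) x)) (hub_graph q ((+) x \<circ> \<tau>))"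
proof -
  let ?L = "(+) x"
  let ?A = "{Leaf p s | p s. p \<in> {1..<q} \<and> s < ?L p}"
  define f :: "nat \<Rightarrow> nat" where "f = (\<lambda>n. to_nat (relabel (inv \<tau>) (from_nat n)))"
  have inv: "inv \<tau> permutes {..<q}" using \<tau>(1) by (rule permutes_inv)
  have f: "f (to_nat v) = to_nat (relabel (inv \<tau>) v)" for v by (simp add: f_def)
  have "(q - 1) * x = (\<Sum>p\<in>{1..<q}. x)" by simp
  also have "\<dots> \<le> (\<Sum>p\<in>{1..<q}. x + p)" by (rule sum_mono) simp
  also have "\<dots> = card ?A" by (rule card_leaves[symmetric]) simp
  also have "\<dots> = card (to_nat ` ?A)" by (simp add: card_to_nat_image)
  also have "\<dots> \<le> common_cards (hub_graph q ?L) (hub_graph q (?L \<circ> \<tau>))"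
  proof (rule common_cards_ge[where f = f])
    show "inj_on f (to_nat ` ?A)"
      using inj_relabel[OF permutes_inj[OF inv]] by (auto simp: inj_on_def f dest: injD)
    show "f ` to_nat ` ?A \<subseteq> verts (hub_graph q (?L \<circ> \<tau>))"
      using permutes_in_image[OF inv] permutes_inverses[OF \<tau>(1)] by (auto simp: f)
    fix n assume "n \<in> to_nat ` ?A"
    then obtain p s where "n = to_nat (Leaf p s)" "0 < p" "p < q" "s < ?L p" by auto
    then show "iso_class (pre_digraph.del_vert (hub_graph q ?L) n)
        = iso_class (pre_digraph.del_vert (hub_graph q (?L \<circ> \<tau>)) (f n))"
      using iso_class_delete_leaf[of p q s ?L, OF _ _ _ _ \<tau>] by (simp add: f del_vert_ind_graph)
  qed (auto simp: finite_vertices)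
  finally show ?thesis .
qed

section \<open>Choice of parameters and the limit superior\<close>

lemma exists_pair_many_common_cards:
  assumes q: "q \<ge> 3"
  obtains c where "\<And>x. x \<ge> 2 \<Longrightarrow> \<exists>(G :: nat pair_pre_digraph) (H :: nat pair_pre_digraph).
    pair_graph G \<and> pair_graph H \<and>
    card (pverts G) = q * x + c \<and> card (pverts H) = q * x + c \<and>
    Digraph_Component.connected G \<and> Digraph_Component.connected H \<and>
    \<not> digraph_iso G H \<and> degree_sequence G = degree_sequence H \<and>
    (q - 1) * x \<le> common_cards G H"
proof -
  \<comment> \<open>Everything in the order of the graphs that does not depend on \<open>x\<close>,
    including the surplus \<open>p\<close> of leaves at hub \<open>p\<close>.\<close>
  define c where "c = (\<Sum>p<q. p) + (q + card (even_orders q) * q)"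
  define \<tau> :: "nat \<Rightarrow> nat" where "\<tau> = transpose 0 1"
  have \<tau>: "\<tau> permutes {..<q}" "\<not> evenperm \<tau>"
    unfolding \<tau>_def using q by (auto simp: evenperm_swap intro!: permutes_swap_id)
  show thesis
  proof (rule that[of c])
    fix x :: nat assume x: "x \<ge> 2"
    let ?G = "hub_graph q ((+) x)" and ?H = "hub_graph q ((+) x \<circ> \<tau>)"
    have "card (vertices q ((+) x)) = q * x + c"
      by (simp add: card_vertices sum.distrib c_def)
    moreover have "(\<Sum>p<q. x + \<tau> p) = (\<Sum>p<q. x + p)"
      using sum.permute[OF \<tau>(1), of "(+) x"] by (simp add: comp_def)
    then have "card (vertices q ((+) x \<circ> \<tau>)) = q * x + c"
      by (simp add: card_vertices sum.distrib c_def)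
    moreover have "\<not> digraph_iso ?G ?H"
      using evenperm_if_digraph_iso[OF q, of "(+) x" \<tau>] \<tau> x by (auto simp: inj_on_def)
    moreover have "degree_sequence ?G = degree_sequence ?H"
      using degree_sequence_hub_graph[OF q \<tau>(1)] by simp
    moreover have "pair_graph (hub_graph q L)" for L
      using finite_vertices symp_adj irreflp_adj by (rule pair_graph_ind_graph)
    moreover have "Digraph_Component.connected (hub_graph q L)" for L
      using q by (intro connected_hub_graph) simp
    ultimately show "\<exists>(G :: nat pair_pre_digraph) (H :: nat pair_pre_digraph).
      pair_graph G \<and> pair_graph H \<and>
      card (pverts G) = q * x + c \<and> card (pverts H) = q * x + c \<and>
      Digraph_Component.connected G \<and> Digraph_Component.connected H \<and>
      \<not> digraph_iso G H \<and> degree_sequence G = degree_sequence H \<and>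
      (q - 1) * x \<le> common_cards G H"
      using common_cards_hub_graph[OF \<tau>, of x]
      by - (rule exI[of _ ?G], rule exI[of _ ?H], simp add: card_to_nat_image)
  qed
qed

lemma infinite_many_common_cards:
  fixes \<epsilon> :: real
  assumes "\<epsilon> > 0"
  shows "infinite {n::nat. n > 0 \<and>
    (\<exists>(G :: nat pair_pre_digraph) (H :: nat pair_pre_digraph).
       pair_graph G \<and> pair_graph H \<and>
       card (pverts G) = n \<and> card (pverts H) = n \<and>
       Digraph_Component.connected G \<and> Digraph_Component.connected H \<and>
       \<not> digraph_iso G H \<and>
       degree_sequence G = degree_sequence H \<and>
       real (common_cards G H) > (1 - \<epsilon>) * real n)}" (is "infinite ?S")
  unfolding infinite_nat_iff_unbounded
proof
  fix m :: nat
  \<comment> \<open>The limiting proportion \<open>1 - 1 / q\<close> has to exceed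
    \<open>1 - \<epsilon>\<close>, that is, \<open>\<epsilon> * q > 1\<close>.\<close>
  obtain q0 :: nat where "1 / \<epsilon> < real q0" using reals_Archimedean2 by blast
  define q where "q = max 3 q0"
  have "1 / \<epsilon> < real q" using \<open>1 / \<epsilon> < real q0\<close> by (simp add: q_def)
  then have q: "q \<ge> 3" "\<epsilon> * real q - 1 > 0"
    using assms by (simp_all add: q_def field_simps)
  obtain c where c: "\<And>x. x \<ge> 2 \<Longrightarrow> \<exists>(G :: nat pair_pre_digraph) (H :: nat pair_pre_digraph).
    pair_graph G \<and> pair_graph H \<and>
    card (pverts G) = q * x + c \<and> card (pverts H) = q * x + c \<and>
    Digraph_Component.connected G \<and> Digraph_Component.connected H \<and>
    \<not> digraph_iso G H \<and> degree_sequence G = degree_sequence H \<and>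
    (q - 1) * x \<le> common_cards G H"
    using exists_pair_many_common_cards[OF q(1)] by blast
  obtain x0 :: nat where x0: "real c / (\<epsilon> * real q - 1) < real x0" using reals_Archimedean2 by blast
  \<comment> \<open>The goal \<open>(q - 1) * x > (1 - \<epsilon>) * (q * x + c)\<close> amounts to
    \<open>(\<epsilon> * q - 1) * x > (1 - \<epsilon>) * c\<close>, which \<open>x0\<close> secures.
    The summand \<open>m\<close> makes the order exceed \<open>m\<close>, and 2 gives every hub two
    leaves.\<close>
  define x where "x = x0 + m + 2"
  have "real c / (\<epsilon> * real q - 1) < real x" using x0 by (simp add: x_def)
  then have "real c < (\<epsilon> * real q - 1) * real x" using q(2) by (simp add: field_simps)
  moreover have "(1 - \<epsilon>) * real c \<le> real c" using assms by (simp add: algebra_simps)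
  ultimately have "(1 - \<epsilon>) * real (q * x + c) < real ((q - 1) * x)"
    using q(1) by (simp add: algebra_simps of_nat_diff)
  then have "(1 - \<epsilon>) * real (q * x + c) < real b" if "(q - 1) * x \<le> b" for b
    using that by (meson less_le_trans of_nat_mono)
  moreover have "x \<ge> 2" by (simp add: x_def)
  moreover from this have "q * x + c > 0" using q(1) by simp
  ultimately have "q * x + c \<in> ?S"
    using c[of x] by blast
  moreover have "1 * x \<le> q * x" using q(1) by (intro mult_right_mono) auto
  then have "m < q * x + c" by (simp add: x_def)
  ultimately show "\<exists>n>m. n \<in> ?S" by blast
qed

theorem corollary3p4:
  shows "(\<forall>\<epsilon>::real. \<epsilon> > 0 \<longrightarrow>
            infinite {n::nat. n > 0 \<and>
              (\<exists>(G :: nat pair_pre_digraph) (H :: nat pair_pre_digraph).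
                 pair_graph G \<and> pair_graph H \<and>
                 card (pverts G) = n \<and> card (pverts H) = n \<and>
                 Digraph_Component.connected G \<and> Digraph_Component.connected H \<and>
                 \<not> digraph_iso G H \<and>
                 degree_sequence G = degree_sequence H \<and>
                 real (common_cards G H) > (1 - \<epsilon>) * real n)})
       \<and> limsup (\<lambda>n. ereal (real (max_common_cards n) / real n)) = 1"
proof (intro conjI allI impI)
  show "limsup (\<lambda>n. ereal (real (max_common_cards n) / real n)) = 1" (is "limsup ?f = 1")
  proof (rule antisym)
    have "?f n \<le> 1" if "n \<ge> 2" for n
      using max_common_cards_le[OF that] that by (simp add: divide_le_eq)
    then show "limsup ?f \<le> 1"
      by (intro Limsup_bounded eventually_sequentiallyI[of 2])
    show "1 \<le> limsup ?f"
    proof (rule ccontr)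
      assume "\<not> 1 \<le> limsup ?f"
      \<comment> \<open>A number strictly between the limit superior and 1 bounds the ratio for all
        large \<open>n\<close>; the first claim with \<open>1 - r\<close> for
        \<open>\<epsilon>\<close> contradicts this.\<close>
      then obtain r where r: "limsup ?f < ereal r" "ereal r < 1"
        using ereal_dense2[of "limsup ?f" 1] by (auto simp: not_le)
      from Limsup_lessD[OF r(1)] obtain N where N: "\<And>n. n \<ge> N \<Longrightarrow> ?f n < ereal r"
        by (auto simp: eventually_sequentially)
      have "1 - r > 0" using r(2) by (simp add: one_ereal_def)
      from infinite_many_common_cards[OF this, unfolded infinite_nat_iff_unbounded_le]
      obtain n and G H :: "nat pair_pre_digraph" where n: "n \<ge> N" "n > 0"
        and GH: "pair_graph G" "pair_graph H" "card (pverts G) = n" "card (pverts H) = n"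
          "\<not> digraph_iso G H" "real (common_cards G H) > r * real n"
        by (auto dest!: spec[of _ N])
      have "r * real n < real (max_common_cards n)"
        using GH(6) common_cards_le_max[OF GH(1-5)] by linarith
      then have "r < real (max_common_cards n) / real n"
        using n(2) by (simp add: less_divide_eq)
      then show False using N[OF n(1)] by simp
    qed
  qed
qed (rule infinite_many_common_cards)

end
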